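(* Let $\mathcal{G}_{6,4}$ be the real Lie algebra with basis $x_1,\dots,x_6$ and nonzero brackets $[x_1,x_2]=x_4$, $[x_1,x_3]=x_6$, $[x_2,x_4]=x_5$. For real $\alpha,\beta$ with $\alpha\neq-\beta$ let $$J_{\alpha,\beta}=\mathrm{diag}\left(\begin{pmatrix}\alpha&1\\-(\alpha^2+1)&-\alpha\end{pmatrix},\begin{pmatrix}\frac{1-\alpha\beta}{\alpha+\beta}&1\\-\frac{(\alpha^2+1)(\beta^2+1)}{(\alpha+\beta)^2}&\frac{\alpha\beta-1}{\alpha+\beta}\end{pmatrix},\begin{pmatrix}\beta&\frac{(\alpha^2+1)(\beta^2+1)}{\alpha+\beta}\\-\frac{\alpha+\beta}{\alpha^2+1}&-\beta\end{pmatrix}\right).$$ Then every complex structure on $\mathcal{G}_{6,4}$ is equivalent to some $J_{\alpha,\beta}$ with $\alpha\neq-\beta$, and the $J_{\alpha,\beta}$ corresponding to different pairs $(\alpha,\beta)$ are not equivalent. The set $\mathfrak{X}_{6,4}$ of all complex structures on $\mathcal{G}_{6,4}$ is a submanifold of dimension 10 of $\mathbb{R}^{36}$, and it is the disjoint union of the $\mathrm{Aut}(\mathcal{G}_{6,4})$-orbits of the $J_{\alpha,\beta}$.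
   Context: Brackets of basis vectors not listed (and not obtained by antisymmetry) are zero. A complex structure on a real Lie algebra $\mathfrak{g}$ is a linear map $J:\mathfrak{g}\to\mathfrak{g}$ with $J^2=-1$ and $[JX,JY]-[X,Y]-J[JX,Y]-J[X,JY]=0$ for all $X,Y\in\mathfrak{g}$. $J$ is identified with its $6\times 6$ matrix $(\xi^k_j)$ ($k$ the row index, $j$ the column index) in the basis $(x_j)$, i.e. $Jx_j=\sum_k\xi^k_j x_k$; so the set of complex structures is a subset of $\mathbb{R}^{36}$. "Submanifold" means smooth ($C^\infty$) submanifold. $\mathrm{Aut}(\mathfrak{g})$ acts on complex structures by $J\mapsto\Phi^{-1}J\Phi$, and two complex structures are equivalent if they lie in the same orbit. $\mathrm{diag}$ denotes a block-diagonal matrix. *)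

theory Defs
  imports "HOL-Analysis.Analysis" "HOL-Library.Disjoint_Sets"
begin

definition lie_bracket :: "('a::real_vector \<Rightarrow> 'a \<Rightarrow> 'a) \<Rightarrow> bool" where
  "lie_bracket br \<longleftrightarrow>
     (\<forall>x. linear (br x)) \<and> (\<forall>y. linear (\<lambda>x. br x y)) \<and>
     (\<forall>x. br x x = 0) \<and>
     (\<forall>x y z. br x (br y z) + br y (br z x) + br z (br x y) = 0)"

definition complex_structure ::
    "('a::real_vector \<Rightarrow> 'a \<Rightarrow> 'a) \<Rightarrow> ('a \<Rightarrow> 'a) \<Rightarrow> bool" where
  "complex_structure br J \<longleftrightarrow>
     linear J \<and> (\<forall>x. J (J x) = - x) \<and>
     (\<forall>x y. br (J x) (J y) - br x y - J (br (J x) y) - J (br x (J y)) = 0)"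

definition lie_automorphism ::
    "('a::real_vector \<Rightarrow> 'a \<Rightarrow> 'a) \<Rightarrow> ('a \<Rightarrow> 'a) \<Rightarrow> bool" where
  "lie_automorphism br \<phi> \<longleftrightarrow>
     linear \<phi> \<and> bij \<phi> \<and> (\<forall>x y. \<phi> (br x y) = br (\<phi> x) (\<phi> y))"

text \<open>
  For a bracket on coordinate space, linear maps are identified with their matrices in
  the standard basis. Since the component \<open>A $ k $ j\<close> has row index \<open>k\<close> and column index
  \<open>j\<close>, the map \<open>(*v) A\<close> sends the basis vector \<open>x\<^sub>j\<close> to the sum over \<open>k\<close> of
  \<open>A $ k $ j\<close> times \<open>x\<^sub>k\<close>.
\<close>

definition complex_structures ::
    "(real^'n \<Rightarrow> real^'n \<Rightarrow> real^'n) \<Rightarrow> (real^'n^'n) set" where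
  "complex_structures br = {A. complex_structure br ((*v) A)}"

definition aut_orbit ::
    "(real^'n \<Rightarrow> real^'n \<Rightarrow> real^'n) \<Rightarrow> real^'n^'n \<Rightarrow> (real^'n^'n) set" where
  "aut_orbit br A = {matrix_inv P ** A ** P | P. lie_automorphism br ((*v) P)}"

definition equivalent_cs ::
    "(real^'n \<Rightarrow> real^'n \<Rightarrow> real^'n) \<Rightarrow> real^'n^'n \<Rightarrow> real^'n^'n \<Rightarrow> bool" where
  "equivalent_cs br A B \<longleftrightarrow> B \<in> aut_orbit br A"

text \<open>
  \<open>Ck_on k U f\<close> is the usual notion of a map of class C-k only for open \<open>U\<close>: the
  derivatives are taken in the full neighbourhood of each point, and smoothness is
  iterated continuous differentiability of all directional derivatives.
\<close>

primrec Ck_on ::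
    "nat \<Rightarrow> 'a::euclidean_space set \<Rightarrow> ('a \<Rightarrow> 'b::euclidean_space) \<Rightarrow> bool" where
  "Ck_on 0 U f \<longleftrightarrow> continuous_on U f"
| "Ck_on (Suc k) U f \<longleftrightarrow>
     (\<forall>x\<in>U. f differentiable (at x)) \<and>
     (\<forall>v. Ck_on k U (\<lambda>x. frechet_derivative f (at x) v))"

definition smooth_map_on :: "'a::euclidean_space set \<Rightarrow> ('a \<Rightarrow> 'b::euclidean_space) \<Rightarrow> bool" where
  "smooth_map_on U f \<longleftrightarrow> (\<forall>k. Ck_on k U f)"

text \<open>Embedded submanifolds, by slice charts of the ambient space.\<close>

definition smooth_submanifold :: "nat \<Rightarrow> 'a::euclidean_space set \<Rightarrow> bool" where
  "smooth_submanifold d M \<longleftrightarrow>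
     (\<forall>p\<in>M. \<exists>U V \<phi> \<psi> T.
        open U \<and> p \<in> U \<and> open V \<and> homeomorphism U V \<phi> \<psi> \<and>
        smooth_map_on U \<phi> \<and> smooth_map_on V \<psi> \<and>
        subspace T \<and> dim T = d \<and> \<phi> ` (U \<inter> M) = V \<inter> (T :: 'a set))"

text \<open>
  The index type \<open>6\<close> consists of the residues \<open>1, ..., 6\<close> modulo 6 (so \<open>6 = 0\<close> there);
  the basis vector \<open>x\<^sub>i\<close> is \<open>axis i 1\<close>.
\<close>

definition g64 :: "real^6 \<Rightarrow> real^6 \<Rightarrow> real^6" where
  "g64 X Y =
     (X$1 * Y$2 - X$2 * Y$1) *\<^sub>R axis 4 1 +
     (X$1 * Y$3 - X$3 * Y$1) *\<^sub>R axis 6 1 +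
     (X$2 * Y$4 - X$4 * Y$2) *\<^sub>R axis 5 1"

definition J64 :: "real \<Rightarrow> real \<Rightarrow> real^6^6" where
  "J64 \<alpha> \<beta> = vector
    [vector [\<alpha>,            1,   0, 0,  0, 0],
     vector [- (\<alpha>^2 + 1), - \<alpha>,  0, 0,  0, 0],
     vector [0, 0,  (1 - \<alpha> * \<beta>) / (\<alpha> + \<beta>), 1,  0, 0],
     vector [0, 0,  - (((\<alpha>^2 + 1) * (\<beta>^2 + 1)) / (\<alpha> + \<beta>)^2), (\<alpha> * \<beta> - 1) / (\<alpha> + \<beta>),  0, 0],
     vector [0, 0,  0, 0,  \<beta>, ((\<alpha>^2 + 1) * (\<beta>^2 + 1)) / (\<alpha> + \<beta>)],
     vector [0, 0,  0, 0,  - ((\<alpha> + \<beta>) / (\<alpha>^2 + 1)), - \<beta>]]"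

definition params64 :: "(real \<times> real) set" where
  "params64 = {(\<alpha>, \<beta>). \<alpha> \<noteq> - \<beta>}"

lemma UNIV_6: "(UNIV :: 6 set) = {1, 2, 3, 4, 5, 6}"
proof -
  have "card {1, 2, 3, 4, 5, 6 :: 6} = CARD(6)" by simp
  then show ?thesis by (metis card_subset_eq finite subset_UNIV)
qed

lemma lie_bracket_g64: "lie_bracket g64"
  unfolding lie_bracket_def
proof (intro conjI allI)
  show "linear (g64 x)" for x
    by (rule linearI) (simp_all add: g64_def algebra_simps)
  show "linear (\<lambda>x. g64 x y)" for y
    by (rule linearI) (simp_all add: g64_def algebra_simps)
  show "g64 x x = 0" for x by (simp add: g64_def)
  show "g64 x (g64 y z) + g64 y (g64 z x) + g64 z (g64 x y) = 0" for x y z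
    by (simp add: g64_def axis_def algebra_simps)
qed

lemma g64_basis:
  "g64 (axis 1 1) (axis 2 1) = axis 4 1"
  "g64 (axis 1 1) (axis 3 1) = axis 6 1"
  "g64 (axis 2 1) (axis 4 1) = axis 5 1"
  by (simp_all add: g64_def axis_def)

lemma g64_basis_zero:
  assumes "{i, j} \<notin> {{1, 2}, {1, 3}, {2, 4}}"
  shows "g64 (axis i 1) (axis j 1) = 0"
proof -
  have "i \<in> {1, 2, 3, 4, 5, 6}" "j \<in> {1, 2, 3, 4, 5, 6}"
    using UNIV_6 by auto
  with assms show ?thesis
    by (elim insertE emptyE) (simp_all add: g64_def axis_def insert_commute)
qed

end

(*
  The operator ad (J x5) commutes with J, so its image and its kernel are J-stable; together with
  J^2 = -1 this forces J to preserve the centre <x5, x6>, and the same kind of argument modulo the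
  centre shows that J preserves <x3, x4, x5, x6>. The matrix of J is then block lower triangular with
  2x2 diagonal blocks, and J^2 = -1 together with the integrability conditions on the basis pairs
  can be solved explicitly: J is a rational function of the ten entries
  (1,1), (1,2), (5,5), (5,6), (3,2), (4,2), (5,2), (6,2), (5,4), (6,4), which vary freely in an open
  set. So the complex structures form the graph of a smooth map.
  An automorphism P that turns J into its normal form is determined by P x2 = x2: the shape of the
  normal form demands P x1 = J x2 + alpha x2, P x4 = [P x1, P x2], P x3 = J (P x4) + p (P x4) with
  p = (1 - alpha beta)/(alpha + beta), P x5 = [P x2, P x4] and P x6 = [P x1, P x3].
  Finally, automorphisms are triangular enough to leave the entries (1,1) and (5,5), which are alpha
  and beta, unchanged.
*)
theory Submission
  imports Defs
begin

section \<open>Calculus of C-k maps, and graphs as embedded submanifolds\<close>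

section \<open>Smooth maps\<close>

text \<open>\<open>Ck_on\<close> is phrased through \<open>frechet_derivative\<close>; this rule
  lets an explicit derivative formula stand in for it. At points of \<open>U\<close> the derivative
  is unique, so the two agree there.\<close>

lemma Ck_on_SucI:
  assumes "open U" "\<And>x. x \<in> U \<Longrightarrow> (f has_derivative f' x) (at x)"
    and "\<And>v. Ck_on k U (\<lambda>x. f' x v)"
  shows "Ck_on (Suc k) U f"
proof -
  have eq: "frechet_derivative f (at x) = f' x" if "x \<in> U" for x
    using assms(2)[OF that] frechet_derivative_at by metis
  \<comment> \<open>On an open set the values determine the derivatives of every order. This
    transfers \<open>Ck_on\<close> between functions known to agree only on \<open>U\<close>, which
    is all that \<open>eq\<close> provides.\<close>
  have cong: "Ck_on k U g \<Longrightarrow> (\<And>x. x \<in> U \<Longrightarrow> h x = g x) \<Longrightarrow> Ck_on k U h" for g h :: "'a \<Rightarrow> 'b"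
    using \<open>open U\<close>
  proof (induction k arbitrary: g h)
    case 0
    then show ?case by (simp cong: continuous_on_cong)
  next
    case (Suc k)
    have D: "(h has_derivative frechet_derivative g (at x)) (at x)" if "x \<in> U" for x
    proof -
      have "(g has_derivative frechet_derivative g (at x)) (at x)"
        using Suc.prems(1) that by (simp add: frechet_derivative_works)
      then show ?thesis
        by (rule has_derivative_transform_within_open[OF _ \<open>open U\<close> that]) (simp add: Suc.prems(2))
    qed
    have "frechet_derivative h (at x) = frechet_derivative g (at x)" if "x \<in> U" for x
      using D[OF that] frechet_derivative_at by metis
    then have "Ck_on k U (\<lambda>x. frechet_derivative h (at x) v)" for v
      using Suc.prems(1)
      by (intro Suc.IH[where g = "\<lambda>x. frechet_derivative g (at x) v" and
            h = "\<lambda>x. frechet_derivative h (at x) v"] \<open>open U\<close>) simp_all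
    moreover have "h differentiable (at x)" if "x \<in> U" for x
      using D[OF that] by (rule differentiableI)
    ultimately show ?case
      by simp
  qed
  have "Ck_on k U (\<lambda>x. frechet_derivative f (at x) v)" for v
    by (rule cong[OF assms(3)[of v]]) (simp add: eq)
  with assms(2) show ?thesis
    by (auto simp: differentiable_def)
qed

lemma Ck_on_Suc_deriv:
  assumes "Ck_on (Suc k) U f" "x \<in> U"
  shows "(f has_derivative frechet_derivative f (at x)) (at x)"
  using assms frechet_derivative_works by auto

lemma Ck_on_Suc_imp:
  "Ck_on (Suc k) U f \<Longrightarrow> Ck_on k U f"
proof (induction k arbitrary: f)
  case 0
  then show ?case
    by (auto intro!: differentiable_imp_continuous_on
        simp: differentiable_on_def differentiable_at_withinI)
next
  case (Suc k)
  then show ?case by simp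
qed

lemma Ck_on_const: "open U \<Longrightarrow> Ck_on k U (\<lambda>x. c)"
proof (induction k arbitrary: c)
  case (Suc k)
  then show ?case
    by (intro Ck_on_SucI[where f' = "\<lambda>_ _. 0"]) auto
qed simp

lemma Ck_on_bounded_linear:
  assumes "open U" "bounded_linear L" shows "Ck_on k U L"
proof (cases k)
  case 0
  then show ?thesis
    using assms by (simp add: linear_continuous_on)
next
  case (Suc n)
  then show ?thesis
    using assms
    by (auto intro!: Ck_on_SucI[where f' = "\<lambda>_. L"] Ck_on_const bounded_linear_imp_has_derivative
        simp del: Ck_on.simps)
qed

lemma Ck_on_linear_comp:
  assumes "open U" "bounded_linear L" shows "Ck_on k U f \<Longrightarrow> Ck_on k U (\<lambda>x. L (f x))"
proof (induction k arbitrary: f)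
  case 0
  then show ?case
    using assms by (simp add: bounded_linear.continuous_on)
next
  case (Suc k)
  show ?case
    by (rule Ck_on_SucI[where f' = "\<lambda>x v. L (frechet_derivative f (at x) v)"])
      (use Suc assms Ck_on_Suc_deriv[OF Suc.prems] in
        \<open>auto intro: bounded_linear.has_derivative\<close>)
qed

lemma Ck_on_add:
  assumes "open U" shows "Ck_on k U f \<Longrightarrow> Ck_on k U g \<Longrightarrow> Ck_on k U (\<lambda>x. f x + g x)"
proof (induction k arbitrary: f g)
  case 0
  then show ?case by (simp add: continuous_on_add)
next
  case (Suc k)
  show ?case
    by (rule Ck_on_SucI[where
          f' = "\<lambda>x v. frechet_derivative f (at x) v + frechet_derivative g (at x) v"])
      (use Suc assms Ck_on_Suc_deriv[OF Suc.prems(1)] Ck_on_Suc_deriv[OF Suc.prems(2)] in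
        \<open>auto intro: has_derivative_add\<close>)
qed

lemma Ck_on_mult:
  fixes f g :: "'a::euclidean_space \<Rightarrow> real"
  assumes "open U" shows "Ck_on k U f \<Longrightarrow> Ck_on k U g \<Longrightarrow> Ck_on k U (\<lambda>x. f x * g x)"
proof (induction k arbitrary: f g)
  case 0
  then show ?case by (simp add: continuous_on_mult)
next
  case (Suc k)
  \<comment> \<open>The product rule leaves one factor undifferentiated, so the induction needs both
    factors at level \<open>k\<close> as well.\<close>
  have fg: "Ck_on k U f" "Ck_on k U g"
    using Suc.prems Ck_on_Suc_imp by blast+
  show ?case
  proof (rule Ck_on_SucI[where
        f' = "\<lambda>x v. f x * frechet_derivative g (at x) v + frechet_derivative f (at x) v * g x"])
    show "((\<lambda>x. f x * g x) has_derivative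
        (\<lambda>v. f x * frechet_derivative g (at x) v + frechet_derivative f (at x) v * g x)) (at x)"
      if "x \<in> U" for x
      using has_derivative_mult Ck_on_Suc_deriv[OF Suc.prems(1) that] Ck_on_Suc_deriv[OF Suc.prems(2) that]
      by blast
    show "Ck_on k U (\<lambda>x. f x * frechet_derivative g (at x) v + frechet_derivative f (at x) v * g x)" for v
      using Suc fg by (intro Ck_on_add[OF assms] Suc.IH) auto
  qed fact
qed

lemma Ck_on_inverse:
  fixes f :: "'a::euclidean_space \<Rightarrow> real"
  assumes "open U" "\<And>x. x \<in> U \<Longrightarrow> f x \<noteq> 0" shows "Ck_on k U f \<Longrightarrow> Ck_on k U (\<lambda>x. inverse (f x))"
proof (induction k)
  case 0
  then show ?case using assms by (simp add: continuous_on_inverse)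
next
  case (Suc k)
  have f: "Ck_on k U f"
    using Suc.prems Ck_on_Suc_imp by blast
  \<comment> \<open>The derivative of the inverse contains that same inverse, which the induction
    hypothesis covers. The sign is written as a constant factor so that closure under products
    suffices.\<close>
  show ?case
  proof (rule Ck_on_SucI[where
        f' = "\<lambda>x v. (-1) * (inverse (f x) * frechet_derivative f (at x) v * inverse (f x))"])
    show "((\<lambda>x. inverse (f x)) has_derivative
        (\<lambda>v. (-1) * (inverse (f x) * frechet_derivative f (at x) v * inverse (f x)))) (at x)"
      if "x \<in> U" for x
      using Deriv.has_derivative_inverse[OF assms(2)[OF that] Ck_on_Suc_deriv[OF Suc.prems that]]
      by simp
    show "Ck_on k U (\<lambda>x. (-1) * (inverse (f x) * frechet_derivative f (at x) v * inverse (f x)))" for v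
      using Suc f by (intro Ck_on_mult[OF assms(1)] Ck_on_const[OF assms(1)]) auto
  qed fact
qed

lemma smooth_map_on_const: "open U \<Longrightarrow> smooth_map_on U (\<lambda>x. c)"
  by (simp add: smooth_map_on_def Ck_on_const)

lemma smooth_map_on_bounded_linear: "open U \<Longrightarrow> bounded_linear L \<Longrightarrow> smooth_map_on U L"
  by (simp add: smooth_map_on_def Ck_on_bounded_linear)

lemma smooth_map_on_add:
  "open U \<Longrightarrow> smooth_map_on U f \<Longrightarrow> smooth_map_on U g \<Longrightarrow> smooth_map_on U (\<lambda>x. f x + g x)"
  by (simp add: smooth_map_on_def Ck_on_add)

lemma smooth_map_on_minus:
  "open U \<Longrightarrow> smooth_map_on U f \<Longrightarrow> smooth_map_on U (\<lambda>x. - f x)"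
  using Ck_on_linear_comp[OF _ bounded_linear_minus[OF bounded_linear_ident]]
  by (auto simp: smooth_map_on_def)

lemma smooth_map_on_diff:
  assumes "open U" "smooth_map_on U f" "smooth_map_on U g"
  shows "smooth_map_on U (\<lambda>x. f x - g x)"
  using smooth_map_on_add[OF assms(1,2) smooth_map_on_minus[OF assms(1,3)]] by simp

lemma smooth_map_on_mult:
  fixes f g :: "'a::euclidean_space \<Rightarrow> real"
  shows "open U \<Longrightarrow> smooth_map_on U f \<Longrightarrow> smooth_map_on U g \<Longrightarrow> smooth_map_on U (\<lambda>x. f x * g x)"
  by (simp add: smooth_map_on_def Ck_on_mult)

lemma smooth_map_on_power:
  fixes f :: "'a::euclidean_space \<Rightarrow> real"
  assumes "open U" "smooth_map_on U f"
  shows "smooth_map_on U (\<lambda>x. f x ^ n)"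
  by (induction n) (simp_all add: assms smooth_map_on_const smooth_map_on_mult)

lemma smooth_map_on_divide:
  fixes f g :: "'a::euclidean_space \<Rightarrow> real"
  assumes "open U" "smooth_map_on U f" "smooth_map_on U g" "\<And>x. x \<in> U \<Longrightarrow> g x \<noteq> 0"
  shows "smooth_map_on U (\<lambda>x. f x / g x)"
  using assms by (simp add: smooth_map_on_def divide_inverse Ck_on_mult Ck_on_inverse)

lemma smooth_map_on_sum:
  assumes "open U" "\<And>i. i \<in> I \<Longrightarrow> smooth_map_on U (f i)"
  shows "smooth_map_on U (\<lambda>x. \<Sum>i\<in>I. f i x)"
  using assms(2)
  by (induction I rule: infinite_finite_induct)
    (simp_all add: smooth_map_on_const smooth_map_on_add assms(1))

lemma smooth_map_on_componentwise:
  assumes "open U" "\<And>b. b \<in> Basis \<Longrightarrow> smooth_map_on U (\<lambda>x. f x \<bullet> b)"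
  shows "smooth_map_on U f"
proof -
  have "smooth_map_on U (\<lambda>x. (f x \<bullet> b) *\<^sub>R b)" if "b \<in> Basis" for b
    using assms(2)[OF that] Ck_on_linear_comp[OF assms(1) bounded_linear_scaleR_left]
    unfolding smooth_map_on_def by blast
  then have "smooth_map_on U (\<lambda>x. \<Sum>b\<in>Basis. (f x \<bullet> b) *\<^sub>R b)"
    by (intro smooth_map_on_sum assms(1))
  then show ?thesis by (simp add: euclidean_representation)
qed

text \<open>\<open>G\<close> copies the coordinates in \<open>D\<close> and computes the remaining
  ones from them, so its fixed points form a graph over a coordinate plane. Since \<open>U\<close>
  is a cylinder over its \<open>D\<close>-coordinates, a shear that keeps those coordinates maps
  \<open>U\<close> onto itself and can straighten the graph globally.\<close>

lemma smooth_submanifold_graph: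
  fixes G :: "'a::euclidean_space \<Rightarrow> 'a"
  assumes D: "D \<subseteq> Basis" and U: "open U" and G: "smooth_map_on U G"
    and sat: "\<And>x y. (\<And>b. b \<in> D \<Longrightarrow> x \<bullet> b = y \<bullet> b) \<Longrightarrow> x \<in> U \<Longrightarrow> y \<in> U"
    and dep: "\<And>x y. (\<And>b. b \<in> D \<Longrightarrow> x \<bullet> b = y \<bullet> b) \<Longrightarrow> G x = G y"
    and GD: "\<And>x b. b \<in> D \<Longrightarrow> G x \<bullet> b = x \<bullet> b"
  shows "smooth_submanifold (card D) {x \<in> U. G x = x}"
proof -
  define pr where "pr = (\<lambda>x. \<Sum>b\<in>D. (x \<bullet> b) *\<^sub>R b)"
  define T where "T = {x::'a. \<forall>b\<in>Basis. b \<notin> D \<longrightarrow> x \<bullet> b = 0}"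
  \<comment> \<open>On the coordinates in \<open>D\<close> the terms \<open>pr x\<close> and
    \<open>G x\<close> cancel; on the others \<open>pr x\<close> vanishes and the value of
    \<open>G\<close> is subtracted. Hence a fixed point of \<open>G\<close> is sent to
    \<open>pr x\<close>.\<close>
  define \<phi> where "\<phi> = (\<lambda>x. x + pr x - G x)"
  define \<psi> where "\<psi> = (\<lambda>x. x - pr x + G x)"
  have fin: "finite D" using D finite_subset[OF _ finite_Basis] by blast
  have pr_D: "pr x \<bullet> b = (if b \<in> D then x \<bullet> b else 0)" if "b \<in> Basis" for x b
  proof -
    have "pr x \<bullet> b = (\<Sum>d\<in>D. if d = b then x \<bullet> b else 0)"
      unfolding pr_def inner_sum_left
      by (rule sum.cong) (use D that in \<open>auto simp: inner_Basis\<close>)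
    then show ?thesis by (simp add: fin)
  qed
  have pr_lin: "bounded_linear pr"
    unfolding pr_def
    by (intro bounded_linear_sum bounded_linear_scaleR_const bounded_linear_inner_left)
  have coord: "\<phi> x \<bullet> b = x \<bullet> b" "\<psi> x \<bullet> b = x \<bullet> b" if "b \<in> D" for x b
    using that D by (auto simp: \<phi>_def \<psi>_def algebra_simps GD pr_D)
  have pr_cong: "pr x = pr y" if "\<And>b. b \<in> D \<Longrightarrow> x \<bullet> b = y \<bullet> b" for x y
    using that by (simp add: pr_def)
  have inv: "\<psi> (\<phi> x) = x" "\<phi> (\<psi> x) = x" for x
  proof -
    have "pr (\<phi> x) = pr x" "pr (\<psi> x) = pr x" "G (\<phi> x) = G x" "G (\<psi> x) = G x"
      using coord by (auto intro!: pr_cong dep)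
    moreover have "\<psi> (\<phi> x) = \<phi> x - pr (\<phi> x) + G (\<phi> x)" "\<phi> (\<psi> x) = \<psi> x + pr (\<psi> x) - G (\<psi> x)"
      by (simp_all only: \<phi>_def \<psi>_def)
    moreover have "\<phi> x = x + pr x - G x" "\<psi> x = x - pr x + G x"
      by (simp_all only: \<phi>_def \<psi>_def)
    ultimately show "\<psi> (\<phi> x) = x" "\<phi> (\<psi> x) = x"
      by simp_all
  qed
  have mem: "\<phi> x \<in> U" "\<psi> x \<in> U" if "x \<in> U" for x
    using sat[OF _ that] coord by metis+
  have smooth: "smooth_map_on U \<phi>" "smooth_map_on U \<psi>"
    unfolding \<phi>_def \<psi>_def
    by (intro smooth_map_on_add smooth_map_on_diff U G smooth_map_on_bounded_linear
        bounded_linear_ident pr_lin)+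
  have cont: "continuous_on U \<phi>" "continuous_on U \<psi>"
    using smooth by (simp_all add: smooth_map_on_def flip: Ck_on.simps(1))
  have hom: "homeomorphism U U \<phi> \<psi>"
    by (rule homeomorphismI) (use cont mem inv in auto)
  have pr_T: "pr x \<in> T" for x
    by (simp add: T_def pr_D)
  have T_pr: "pr x = x" if "x \<in> T" for x
    by (rule euclidean_eqI) (use that in \<open>auto simp: T_def pr_D\<close>)
  have "\<phi> ` (U \<inter> {x \<in> U. G x = x}) = U \<inter> T"
  proof (intro equalityI subsetI)
    fix y assume "y \<in> \<phi> ` (U \<inter> {x \<in> U. G x = x})"
    then obtain x where x: "x \<in> U" "G x = x" "y = \<phi> x" by blast
    then have "y = pr x" by (simp add: \<phi>_def)
    then have "y \<in> T" by (simp only: pr_T)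
    with x mem show "y \<in> U \<inter> T" by auto
  next
    \<comment> \<open>As \<open>pr\<close> fixes \<open>T\<close>, the preimage of \<open>y\<close>
      is \<open>G y\<close>. It has the same \<open>D\<close>-coordinates as \<open>y\<close>, and
      therefore is fixed by \<open>G\<close>.\<close>
    fix y assume y: "y \<in> U \<inter> T"
    have "\<psi> y = G y" using T_pr y by (simp add: \<psi>_def)
    moreover have "G (\<psi> y) = G y" using coord by (auto intro: dep)
    ultimately show "y \<in> \<phi> ` (U \<inter> {x \<in> U. G x = x})"
      using mem(2)[of y] inv(2)[of y] y by (intro image_eqI[of _ _ "\<psi> y"]) simp_all
  qed
  moreover have "subspace T"
    by (auto simp: T_def subspace_def algebra_simps)
  moreover have "dim T = card D"
    unfolding T_def by (rule dim_substandard[OF D])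
  ultimately show ?thesis
    unfolding smooth_submanifold_def
    using U hom smooth by (intro ballI exI[of _ U] exI[of _ \<phi>] exI[of _ \<psi>] exI[of _ T]) auto
qed

section \<open>Six-dimensional coordinates for vectors, matrices and the bracket\<close>

section \<open>Coordinates\<close>

lemma forall_6: "(\<forall>i::6. P i) \<longleftrightarrow> P 1 \<and> P 2 \<and> P 3 \<and> P 4 \<and> P 5 \<and> P 6"
proof -
  have "(\<forall>i::6. P i) \<longleftrightarrow> (\<forall>i\<in>{1, 2, 3, 4, 5, 6}. P i)"
    by (simp only: UNIV_6[symmetric] ball_UNIV)
  then show ?thesis by simp
qed

lemma sum_6: "sum f (UNIV::6 set) = f 1 + f 2 + f 3 + f 4 + f 5 + f 6"
  unfolding UNIV_6 by (simp add: add.assoc)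

lemma vector_6:
  "(vector [a, b, c, d, e, f] :: ('a::zero)^6) $ 1 = a"
  "(vector [a, b, c, d, e, f] :: ('a::zero)^6) $ 2 = b"
  "(vector [a, b, c, d, e, f] :: ('a::zero)^6) $ 3 = c"
  "(vector [a, b, c, d, e, f] :: ('a::zero)^6) $ 4 = d"
  "(vector [a, b, c, d, e, f] :: ('a::zero)^6) $ 5 = e"
  "(vector [a, b, c, d, e, f] :: ('a::zero)^6) $ 6 = f"
  unfolding vector_def by simp_all

lemma g64_component:
  "g64 X Y $ 1 = 0" "g64 X Y $ 2 = 0" "g64 X Y $ 3 = 0"
  "g64 X Y $ 4 = X$1 * Y$2 - X$2 * Y$1"
  "g64 X Y $ 5 = X$2 * Y$4 - X$4 * Y$2"
  "g64 X Y $ 6 = X$1 * Y$3 - X$3 * Y$1"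
  by (simp_all add: g64_def axis_def)

lemma mult_axis_component:
  fixes A :: "real^'n^'m" shows "(A *v axis j 1) $ i = A $ i $ j"
  by (simp add: matrix_vector_mul_component axis_def inner_vec_def if_distrib cong: if_cong)

lemma mult_component_6:
  fixes A :: "real^6^'n"
  shows "(A *v x) $ i = A$i$1 * x$1 + A$i$2 * x$2 + A$i$3 * x$3 + A$i$4 * x$4 + A$i$5 * x$5 + A$i$6 * x$6"
  by (simp add: matrix_vector_mult_def sum_6)

section \<open>Orbits of the automorphism group, for an arbitrary bracket\<close>

section \<open>Conjugation by automorphisms\<close>

lemma lie_automorphism_invertible:
  fixes P :: "real^'n^'n"
  assumes "lie_automorphism br ((*v) P)"
  shows "P ** matrix_inv P = mat 1" "matrix_inv P ** P = mat 1"
proof -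
  have "invertible P"
    using assms by (simp add: lie_automorphism_def invertible_eq_bij)
  \<comment> \<open>\<open>matrix_inv\<close> is a choice among two-sided inverses; invertibility
    says that there is one to choose.\<close>
  then have "P ** matrix_inv P = mat 1 \<and> matrix_inv P ** P = mat 1"
    unfolding invertible_def matrix_inv_def by (rule someI_ex)
  then show "P ** matrix_inv P = mat 1" "matrix_inv P ** P = mat 1"
    by simp_all
qed

lemma lie_automorphism_matrix_inv:
  fixes P :: "real^'n^'n"
  assumes "lie_automorphism br ((*v) P)"
  shows "lie_automorphism br ((*v) (matrix_inv P))"
proof -
  let ?Q = "matrix_inv P"
  note inv = lie_automorphism_invertible[OF assms]
  have PQ: "P *v (?Q *v x) = x" and QP: "?Q *v (P *v x) = x" for x
    by (simp_all add: matrix_vector_mul_assoc inv)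
  have "?Q *v br x y = br (?Q *v x) (?Q *v y)" for x y
  proof -
    have "P *v br (?Q *v x) (?Q *v y) = br x y"
      using assms by (simp add: lie_automorphism_def PQ)
    then show ?thesis using QP by metis
  qed
  moreover have "bij ((*v) ?Q)"
    by (rule bij_betw_byWitness[where f' = "(*v) P"]) (auto simp: PQ QP)
  ultimately show ?thesis
    by (simp add: lie_automorphism_def matrix_vector_mul_linear)
qed

text \<open>The Nijenhuis tensor is natural: because \<open>P\<close> and its inverse preserve
  brackets, the tensor of the conjugate at \<open>x\<close>, \<open>y\<close> is the inverse of
  \<open>P\<close> applied to the tensor of \<open>A\<close> at \<open>P *v x\<close>,
  \<open>P *v y\<close>.\<close>

lemma complex_structures_conj:
  fixes P :: "real^'n^'n"
  assumes A: "A \<in> complex_structures br" and P: "lie_automorphism br ((*v) P)"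
  shows "matrix_inv P ** A ** P \<in> complex_structures br"
proof -
  let ?Q = "matrix_inv P"
  note inv = lie_automorphism_invertible[OF P]
  have PQ: "P *v (?Q *v x) = x" and QP: "?Q *v (P *v x) = x" for x
    by (simp_all add: matrix_vector_mul_assoc inv)
  have hom: "br (P *v x) (P *v y) = P *v br x y" "br (?Q *v x) (?Q *v y) = ?Q *v br x y" for x y
    using P lie_automorphism_matrix_inv[OF P] by (simp_all add: lie_automorphism_def)
  have sq: "A *v (A *v x) = - x"
    and N: "br (A *v x) (A *v y) - br x y - A *v br (A *v x) y - A *v br x (A *v y) = 0" for x y
    using A by (simp_all add: complex_structures_def complex_structure_def)
  define B where "B = ?Q ** A ** P"
  have B: "B *v x = ?Q *v (A *v (P *v x))" for x
    by (simp add: B_def matrix_vector_mul_assoc matrix_mul_assoc)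
  have "B *v (B *v x) = - x" for x
    using linear_neg[OF matrix_vector_mul_linear[of ?Q]] by (simp add: B PQ QP sq)
  moreover have "br (B *v x) (B *v y) - br x y - B *v br (B *v x) y - B *v br x (B *v y) = 0" for x y
  proof -
    let ?x = "P *v x" and ?y = "P *v y"
    have "br x y = ?Q *v br ?x ?y"
      by (simp add: hom QP)
    moreover have "B *v br (B *v x) y = ?Q *v (A *v br (A *v ?x) ?y)"
      by (simp add: B PQ flip: hom(1))
    moreover have "B *v br x (B *v y) = ?Q *v (A *v br ?x (A *v ?y))"
      by (simp add: B PQ flip: hom(1))
    moreover have "br (B *v x) (B *v y) = ?Q *v br (A *v ?x) (A *v ?y)"
      by (simp add: B hom)
    ultimately have "br (B *v x) (B *v y) - br x y - B *v br (B *v x) y - B *v br x (B *v y)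
        = ?Q *v (br (A *v ?x) (A *v ?y) - br ?x ?y - A *v br (A *v ?x) ?y - A *v br ?x (A *v ?y))"
      by (simp add: matrix_vector_mult_diff_distrib)
    then show ?thesis by (simp add: N)
  qed
  ultimately show ?thesis
    by (simp add: complex_structures_def complex_structure_def matrix_vector_mul_linear B_def)
qed

lemma mem_aut_orbit_sym:
  assumes "B \<in> aut_orbit br A"
  shows "A \<in> aut_orbit br B"
proof -
  obtain P where P: "lie_automorphism br ((*v) P)" and B: "B = matrix_inv P ** A ** P"
    using assms by (auto simp: aut_orbit_def)
  let ?Q = "matrix_inv P"
  note invP = lie_automorphism_invertible[OF P]
    and Q = lie_automorphism_matrix_inv[OF P]
  note invQ = lie_automorphism_invertible[OF Q]
  have "matrix_inv ?Q = P"
    using invP invQ by (metis matrix_mul_assoc matrix_mul_lid matrix_mul_rid)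
  then have "matrix_inv ?Q ** B ** ?Q = (P ** ?Q) ** A ** (P ** ?Q)"
    by (simp add: B matrix_mul_assoc)
  then have "matrix_inv ?Q ** B ** ?Q = A"
    by (simp add: invP)
  with Q show ?thesis by (auto simp: aut_orbit_def)
qed

text \<open>The intertwining relation spares computing inverses of explicit matrices.\<close>

lemma mem_aut_orbitI:
  assumes "lie_automorphism br ((*v) P)" "A ** P = P ** B"
  shows "B \<in> aut_orbit br A"
proof -
  have "matrix_inv P ** A ** P = (matrix_inv P ** P) ** B"
    by (simp add: assms(2) flip: matrix_mul_assoc)
  with assms(1) show ?thesis
    by (auto simp: aut_orbit_def lie_automorphism_invertible intro!: exI[of _ P])
qed

lemma mem_aut_orbitE:
  assumes "B \<in> aut_orbit br A"
  obtains P where "lie_automorphism br ((*v) P)" "A ** P = P ** B"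
proof -
  obtain P where P: "lie_automorphism br ((*v) P)" and B: "B = matrix_inv P ** A ** P"
    using assms by (auto simp: aut_orbit_def)
  have "P ** B = (P ** matrix_inv P) ** A ** P"
    by (simp add: B matrix_mul_assoc)
  then show ?thesis
    using that P by (simp add: lie_automorphism_invertible)
qed

section \<open>Shape of automorphisms, and the normal forms with their invariants\<close>

section \<open>Automorphisms of the Lie algebra\<close>

text \<open>Columns 4, 5 and 6 are brackets of other columns, which gives most of the zeros. Columns
  5 and 6 are thereby confined to their diagonal entries, which are nonzero by injectivity. These
  entries are products of earlier diagonal entries, so those are nonzero too.\<close>

lemma lie_automorphism_g64_shape:
  assumes "lie_automorphism g64 ((*v) P)"
  shows "P$2$1 = 0" "P$1$2 = 0" "P$1$3 = 0" "P$1$4 = 0" "P$1$5 = 0" "P$1$6 = 0"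
    "P$2$5 = 0" "P$3$5 = 0" "P$4$5 = 0" "P$6$5 = 0" "P$5$6 = 0" "P$1$1 \<noteq> 0" "P$5$5 \<noteq> 0"
proof -
  have hom: "(P *v g64 (axis i 1) (axis j 1)) $ k = g64 (P *v axis i 1) (P *v axis j 1) $ k" for i j k
    using assms by (simp add: lie_automorphism_def)
  have inj: "inj ((*v) P)"
    using assms by (simp add: lie_automorphism_def bij_is_inj)
  have nz: "\<exists>k. P $ k $ j \<noteq> 0" for j
  proof (rule ccontr)
    assume "\<nexists>k. P $ k $ j \<noteq> 0"
    then have "P *v axis j 1 = P *v 0"
      by (simp add: vec_eq_iff mult_axis_component)
    with inj have "axis j (1::real) = 0" by (simp only: inj_eq)
    then show False by (simp add: axis_eq_0_iff)
  qed
  note comp = g64_component mult_axis_component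
  have c4: "P$k$4 = g64 (P *v axis 1 1) (P *v axis 2 1) $ k" for k
    using hom[of 1 2 k] by (simp add: g64_basis mult_axis_component)
  have c6: "P$k$6 = g64 (P *v axis 1 1) (P *v axis 3 1) $ k" for k
    using hom[of 1 3 k] by (simp add: g64_basis mult_axis_component)
  have c5: "P$k$5 = g64 (P *v axis 2 1) (P *v axis 4 1) $ k" for k
    using hom[of 2 4 k] by (simp add: g64_basis mult_axis_component)
  have z4: "P$1$4 = 0" "P$2$4 = 0" "P$3$4 = 0"
    unfolding c4 by (simp_all add: g64_component)
  have z6: "P$1$6 = 0" "P$2$6 = 0" "P$3$6 = 0"
    unfolding c6 by (simp_all add: g64_component)
  have z5: "P$1$5 = 0" "P$2$5 = 0" "P$3$5 = 0" "P$4$5 = 0" "P$6$5 = 0"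
    unfolding c5 by (simp_all add: comp z4)
  have p55: "P$5$5 = P$2$2 * P$4$4"
    unfolding c5 by (simp add: comp z4)
  have n55: "P$5$5 \<noteq> 0"
  proof
    assume "P$5$5 = 0"
    then have "\<forall>k. P$k$5 = 0" unfolding forall_6 using z5 by simp
    with nz show False by blast
  qed
  then have n44: "P$2$2 \<noteq> 0" "P$4$4 \<noteq> 0" using p55 by auto
  \<comment> \<open>The remaining zeros come from the vanishing brackets of x1 and x4, x3 and x4, x2
    and x3, after cancelling a nonzero diagonal entry.\<close>
  have p21: "P$2$1 = 0"
    using hom[of 1 4 5] n44 by (simp add: comp g64_basis_zero doubleton_eq_iff z4)
  have p23: "P$2$3 = 0"
    using hom[of 3 4 5] n44 by (simp add: comp g64_basis_zero doubleton_eq_iff z4)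
  have p13: "P$1$3 = 0"
    using hom[of 2 3 4] n44 p23 by (simp add: comp g64_basis_zero doubleton_eq_iff)
  have p44: "P$4$4 = P$1$1 * P$2$2"
    unfolding c4 by (simp add: comp p21)
  have p56: "P$4$6 = 0" "P$5$6 = 0" "P$6$6 = P$1$1 * P$3$3"
    unfolding c6 by (simp_all add: comp p21 p23 p13)
  have "P$6$6 \<noteq> 0"
  proof
    assume "P$6$6 = 0"
    then have "\<forall>k. P$k$6 = 0" unfolding forall_6 using z6 p56 by simp
    with nz show False by blast
  qed
  then have "P$3$3 \<noteq> 0" using p56 by auto
  then have p12: "P$1$2 = 0"
    using hom[of 2 3 6] p13 by (simp add: comp g64_basis_zero doubleton_eq_iff)
  show "P$2$1 = 0" "P$1$2 = 0" "P$1$3 = 0" "P$1$4 = 0" "P$1$5 = 0" "P$1$6 = 0"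
    "P$2$5 = 0" "P$3$5 = 0" "P$4$5 = 0" "P$6$5 = 0" "P$5$6 = 0" "P$1$1 \<noteq> 0" "P$5$5 \<noteq> 0"
    using p21 p12 p13 z4 z5 z6 p56 n55 n44 p44 by auto
qed

text \<open>These automorphisms fix x2. Columns 4, 5 and 6 are the brackets of columns 1 and 2, 2
  and 4, 1 and 3; the zero in row 4 of column 3 is forced because x2 and x3 commute. The matrix is
  lower triangular with nonzero diagonal.\<close>

lemma lie_automorphism_g64I:
  assumes "b \<noteq> 0" "v \<noteq> 0"
  shows "lie_automorphism g64 ((*v) (vector
    [vector [b,  0, 0,   0,    0, 0],
     vector [0,  1, 0,   0,    0, 0],
     vector [r3, 0, v,   0,    0, 0],
     vector [r4, 0, 0,   b,    0, 0],
     vector [r5, 0, v5, - r4,  b, 0],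
     vector [r6, 0, v6,  0,    0, b * v]]))"
  (is "lie_automorphism g64 ((*v) ?P)")
proof -
  have lin: "linear ((*v) ?P)" by (rule matrix_vector_mul_linear)
  have "x = 0" if "?P *v x = 0" for x
  proof -
    have "\<forall>i. (?P *v x) $ i = 0" using that by simp
    then show ?thesis
      using assms unfolding forall_6 vec_eq_iff mult_component_6 vector_6 by auto
  qed
  then have "inj ((*v) ?P)"
    using lin by (simp add: linear_injective_0)
  then have "bij ((*v) ?P)"
    using lin by (simp add: bij_def linear_injective_imp_surjective)
  moreover have "?P *v g64 x y = g64 (?P *v x) (?P *v y)" for x y
    unfolding vec_eq_iff forall_6 g64_component mult_component_6 vector_6
    by (simp add: algebra_simps)
  ultimately show ?thesis
    using lin by (simp add: lie_automorphism_def)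
qed

lemma J64_components:
  "J64 \<alpha> \<beta> $ 1 = vector [\<alpha>, 1, 0, 0, 0, 0]"
  "J64 \<alpha> \<beta> $ 2 = vector [- (\<alpha>^2 + 1), - \<alpha>, 0, 0, 0, 0]"
  "J64 \<alpha> \<beta> $ 3 = vector [0, 0, (1 - \<alpha> * \<beta>) / (\<alpha> + \<beta>), 1, 0, 0]"
  "J64 \<alpha> \<beta> $ 4 = vector [0, 0, - (((\<alpha>^2 + 1) * (\<beta>^2 + 1)) / (\<alpha> + \<beta>)^2), (\<alpha> * \<beta> - 1) / (\<alpha> + \<beta>), 0, 0]"
  "J64 \<alpha> \<beta> $ 5 = vector [0, 0, 0, 0, \<beta>, ((\<alpha>^2 + 1) * (\<beta>^2 + 1)) / (\<alpha> + \<beta>)]"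
  "J64 \<alpha> \<beta> $ 6 = vector [0, 0, 0, 0, - ((\<alpha> + \<beta>) / (\<alpha>^2 + 1)), - \<beta>]"
  by (simp_all add: J64_def vector_6)

lemma J64_complex_structure:
  assumes "\<alpha> + \<beta> \<noteq> 0"
  shows "J64 \<alpha> \<beta> \<in> complex_structures g64"
proof -
  have sq_nz: "\<alpha>\<^sup>2 + 1 \<noteq> 0" by (metis add.commute sum_power2_eq_zero_iff one_power2 one_neq_zero)
  \<comment> \<open>With names for the fractional entries, the matrix computations become
    polynomial; denominators are cleared only in \<open>sq\<close> and \<open>N\<close>.\<close>
  define p c w where "p = (1 - \<alpha> * \<beta>) / (\<alpha> + \<beta>)"
    "c = (\<alpha>\<^sup>2 + 1) * (\<beta>\<^sup>2 + 1) / (\<alpha> + \<beta>)" "w = - ((\<alpha> + \<beta>) / (\<alpha>\<^sup>2 + 1))"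
  define a q where "a = - (\<alpha>\<^sup>2 + 1)" "q = - (((\<alpha>\<^sup>2 + 1) * (\<beta>\<^sup>2 + 1)) / (\<alpha> + \<beta>)\<^sup>2)"
  note defs = p_c_w_def a_q_def
  have p_neg: "(\<alpha> * \<beta> - 1) / (\<alpha> + \<beta>) = - p"
    unfolding defs minus_divide_left by simp
  have J: "J64 \<alpha> \<beta> = vector
    [vector [\<alpha>, 1, 0, 0, 0, 0],
     vector [a, - \<alpha>, 0, 0, 0, 0],
     vector [0, 0, p, 1, 0, 0],
     vector [0, 0, q, - p, 0, 0],
     vector [0, 0, 0, 0, \<beta>, c],
     vector [0, 0, 0, 0, w, - \<beta>]]"
    unfolding J64_def defs[symmetric] p_neg by simp
  have sq: "a = - 1 - \<alpha> * \<alpha>" "q = - 1 - p * p" "c * w = - 1 - \<beta> * \<beta>"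
    unfolding defs using assms sq_nz by (simp_all add: divide_simps) algebra+
  \<comment> \<open>Scalar relations between the entries from which the vanishing of the Nijenhuis
    tensor follows.\<close>
  have N: "\<alpha> - a * w + \<beta> = 0" "- a * p - a * \<beta> - c = 0" "1 + (\<alpha> + p) * w = 0"
    "\<alpha> * p - 1 + (\<alpha> + p) * \<beta> = 0" "a * q - (\<alpha> + p) * c = 0" "p + \<beta> - q * w = 0"
    "- \<alpha> * q - c - q * \<beta> = 0"
    unfolding defs using assms sq_nz by (simp_all add: divide_simps) algebra+
  have "J64 \<alpha> \<beta> *v (J64 \<alpha> \<beta> *v x) = - x" for x
  proof -
    have "c * (w * x $ i) = - x $ i - \<beta> * (\<beta> * x $ i)" for i
      using sq(3) by algebra
    then show ?thesis
      unfolding vec_eq_iff forall_6 mult_component_6 J vector_6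
      by (simp add: algebra_simps sq(1,2))
  qed
  moreover have "g64 (J64 \<alpha> \<beta> *v x) (J64 \<alpha> \<beta> *v y) - g64 x y
      - J64 \<alpha> \<beta> *v g64 (J64 \<alpha> \<beta> *v x) y - J64 \<alpha> \<beta> *v g64 x (J64 \<alpha> \<beta> *v y) = 0" for x y
    unfolding vec_eq_iff forall_6 vector_minus_component zero_index g64_component mult_component_6 J vector_6
    by (intro conjI; (insert sq N, simp only: mult_zero_left mult_zero_right mult_1_left add_0 add_0_right
      diff_self diff_0_right, (algebra | simp add: algebra_simps)?))
  ultimately show ?thesis
    by (simp add: complex_structures_def complex_structure_def matrix_vector_mul_linear)
qed

text \<open>Row 1 and column 5 of an automorphism are zero off the diagonal. Comparing the entries
  (1,1) and (5,5) of the intertwining relations, the nonzero diagonal entry cancels.\<close>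

lemma mem_aut_orbit_J64_components:
  assumes "B \<in> aut_orbit g64 (J64 \<alpha> \<beta>)"
  shows "B$1$1 = \<alpha>" "B$5$5 = \<beta>"
proof -
  obtain P where P: "lie_automorphism g64 ((*v) P)" and eq: "J64 \<alpha> \<beta> ** P = P ** B"
    using assms by (rule mem_aut_orbitE)
  \<comment> \<open>For the entry (5,5) it is column 5 that is sparse, so an automorphism
    multiplying \<open>B\<close> from the right is needed.\<close>
  obtain Q where Q: "lie_automorphism g64 ((*v) Q)" and eq': "B ** Q = Q ** J64 \<alpha> \<beta>"
    using mem_aut_orbit_sym[OF assms] by (rule mem_aut_orbitE)
  have "(J64 \<alpha> \<beta> ** P) $ 1 $ 1 = (P ** B) $ 1 $ 1" by (simp add: eq)
  then show "B$1$1 = \<alpha>"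
    using lie_automorphism_g64_shape[OF P]
    by (simp add: matrix_matrix_mult_def sum_6 J64_components vector_6)
  have "(B ** Q) $ 5 $ 5 = (Q ** J64 \<alpha> \<beta>) $ 5 $ 5" by (simp add: eq')
  then show "B$5$5 = \<beta>"
    using lie_automorphism_g64_shape[OF Q]
    by (simp add: matrix_matrix_mult_def sum_6 J64_components vector_6)
qed

section \<open>Complex structures as the fixed points of a rational map\<close>

section \<open>The chart\<close>

text \<open>On this set no divisor in \<open>graph64\<close> vanishes: the divisor \<open>u\<close>
  has a positive numerator.\<close>

definition chart64 :: "(real^6^6) set" where
  "chart64 = {A. A$1$1 + A$5$5 \<noteq> 0 \<and> A$1$2 \<noteq> 0 \<and> A$5$6 \<noteq> 0}"

text \<open>The ten free entries are copied. The diagonal blocks come from their squares being -1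
  together with integrability, column 1 from applying J^2 = -1 to x2, and column 3 from applying it
  to x4.\<close>

definition graph64 :: "real^6^6 \<Rightarrow> real^6^6" where
  "graph64 A =
    (let \<alpha> = A$1$1; b = A$1$2; \<beta> = A$5$5; c = A$5$6;
         b3 = A$3$2; b4 = A$4$2; b5 = A$5$2; b6 = A$6$2; u5 = A$5$4; u6 = A$6$4;
         p = (1 - \<alpha> * \<beta>) / (\<alpha> + \<beta>);
         u = (1 + \<alpha>\<^sup>2) * (1 + \<beta>\<^sup>2) / (b * c * (\<alpha> + \<beta>));
         q = - (b * c / (\<alpha> + \<beta>));
         w = - ((1 + \<beta>\<^sup>2) / c);
         p5 = (p * u5 - \<beta> * u5 - c * u6) / u;
         p6 = (p * u6 - w * u5 + \<beta> * u6) / u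
     in vector
      [vector [\<alpha>, b, 0, 0, 0, 0],
       vector [- ((1 + \<alpha>\<^sup>2) / b), - \<alpha>, 0, 0, 0, 0],
       vector [(\<alpha> * b3 - p * b3 - u * b4) / b, b3, p, u, 0, 0],
       vector [(\<alpha> * b4 - q * b3 + p * b4) / b, b4, q, - p, 0, 0],
       vector [(\<alpha> * b5 - p5 * b3 - u5 * b4 - \<beta> * b5 - c * b6) / b, b5, p5, u5, \<beta>, c],
       vector [(\<alpha> * b6 - p6 * b3 - u6 * b4 - w * b5 + \<beta> * b6) / b, b6, p6, u6, w, - \<beta>]])"

lemma complex_structures_g64_chart:
  assumes "A \<in> complex_structures g64"
  shows "A \<in> chart64" "graph64 A = A"
proof -
  define a where "a i j = A $ i $ j" for i j
  have sq_vec: "A *v (A *v x) = - x"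
    and N_vec: "g64 (A *v x) (A *v y) - g64 x y - A *v g64 (A *v x) y - A *v g64 x (A *v y) = 0" for x y
    using assms by (simp_all add: complex_structures_def complex_structure_def)
  have ax: "axis j (1::real) $ i = (if i = j then 1 else 0)" for i j :: 6
    by (simp add: axis_def)
  have col: "(A *v axis j 1) $ i = a i j" for i j
    by (simp add: a_def mult_axis_component)
  have mv: "(A *v x) $ i = a i 1 * x$1 + a i 2 * x$2 + a i 3 * x$3 + a i 4 * x$4 + a i 5 * x$5 + a i 6 * x$6" for x i
    by (simp add: a_def mult_component_6)
  have sq: "a i 1 * a 1 j + a i 2 * a 2 j + a i 3 * a 3 j + a i 4 * a 4 j + a i 5 * a 5 j + a i 6 * a 6 j
      = - axis j 1 $ i" for i j
    unfolding col[symmetric, of _ j] mv[symmetric] by (simp add: sq_vec)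
  have N: "g64 (A *v axis i 1) (A *v axis j 1) $ k - g64 (axis i 1) (axis j 1) $ k
      - (A *v g64 (A *v axis i 1) (axis j 1)) $ k - (A *v g64 (axis i 1) (A *v axis j 1)) $ k = 0" for i j k
    using arg_cong[OF N_vec, of "\<lambda>v. v $ k"] by simp
  note N = N[unfolded mv g64_component, unfolded col]
  \<comment> \<open>The source of the contradictions below: J has no real eigenvector.\<close>
  have no_sqrt: "x * x \<noteq> -1" for x :: real
    using zero_le_square[of x] by linarith

  \<comment> \<open>The bracket of J x5 with x3 is \<open>a 1 5\<close> times x6. If this is
    nonzero, integrability on the pairs (5,3) and (6,2) and J^2 = -1 make x6 an eigenvector of
    J.\<close>
  have a15: "a 1 5 = 0"
  proof (rule ccontr)
    assume nz: "a 1 5 \<noteq> 0"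
    have col6: "a 1 6 = 0" "a 2 6 = 0" "a 3 6 = 0"
      using N[of 5 3 1] N[of 5 3 2] N[of 5 3 3] nz by (simp_all add: g64_component ax col)
    then have "a 4 6 = 0"
      using N[of 6 2 1] nz by (simp add: g64_component ax col)
    with col6 have "a 5 6 = 0"
      using sq[of 1 6] nz by (simp add: ax col)
    with col6 \<open>a 4 6 = 0\<close> show False
      using sq[of 6 6] no_sqrt by (simp add: ax col)
  qed
  \<comment> \<open>Components 2 and 4 of integrability on the pairs (5,4) and (5,2) reduce to the
    squares of \<open>a 2 5\<close> and \<open>a 4 5\<close>, up to sign.\<close>
  have a25: "a 2 5 = 0"
    using N[of 5 4 2] by (simp add: g64_component ax col)
  have a45: "a 4 5 = 0"
    using N[of 5 2 4] a15 a25 by (simp add: g64_component ax col)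
  \<comment> \<open>Now the bracket of J x5 with x1 is a multiple of x6, and x6 would again be an
    eigenvector.\<close>
  have a35: "a 3 5 = 0"
  proof (rule ccontr)
    assume nz: "a 3 5 \<noteq> 0"
    have "a 1 6 = 0" "a 2 6 = 0" "a 3 6 = 0" "a 4 6 = 0" "a 5 6 = 0"
      using N[of 5 1 1] N[of 5 1 2] N[of 5 1 3] N[of 5 1 4] N[of 5 1 5] nz a15 a25 a45
      by (simp_all add: g64_component ax col)
    then show False
      using sq[of 6 6] no_sqrt by (simp add: ax col)
  qed
  note col5 = a15 a25 a35 a45
  have w: "a 5 6 * a 6 5 = - (1 + a 5 5 * a 5 5)"
    using sq[of 5 5] col5 by (simp add: ax col)
  then have c_nz: "a 5 6 \<noteq> 0" and w_nz: "a 6 5 \<noteq> 0"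
    using no_sqrt[of "a 5 5"] by auto
  have col6: "a 1 6 = 0" "a 2 6 = 0" "a 3 6 = 0" "a 4 6 = 0"
    using sq[of 1 5] sq[of 2 5] sq[of 3 5] sq[of 4 5] col5 w_nz by (simp_all add: ax col)
  \<comment> \<open>An off-diagonal entry of the square of a 2x2 block is that entry of the block
    times the trace, so the block is traceless. The other two diagonal blocks are treated
    alike.\<close>
  have "a 5 6 * (a 5 5 + a 6 6) = 0"
    using sq[of 5 6] col6 by (simp add: ax col algebra_simps)
  then have a66: "a 6 6 = - a 5 5"
    using c_nz by (simp add: eq_neg_iff_add_eq_0 add.commute)
  \<comment> \<open>With J stable on the centre, the squares of \<open>a 2 4\<close> and
    \<open>a 1 4\<close> are what remains of these conditions.\<close>
  have a24: "a 2 4 = 0"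
    using N[of 1 4 2] col5 col6 by (simp add: g64_component ax col)
  have a14: "a 1 4 = 0"
    using N[of 2 4 1] col5 col6 by (simp add: g64_component ax col)
  have uq: "a 4 3 * a 3 4 + a 4 4 * a 4 4 = -1"
    using sq[of 4 4] a14 a24 col5 col6 by (simp add: ax col)
  then have u_nz: "a 3 4 \<noteq> 0"
    using no_sqrt by auto
  have a13: "a 1 3 = 0" and a23: "a 2 3 = 0"
    using sq[of 1 4] sq[of 2 4] u_nz a14 a24 col5 col6 by (simp_all add: ax col)
  note zeros = col5 col6 a13 a14 a23 a24
  have "a 3 4 * (a 3 3 + a 4 4) = 0"
    using sq[of 3 4] zeros by (simp add: ax col algebra_simps)
  then have a44: "a 4 4 = - a 3 3"
    using u_nz by (simp add: eq_neg_iff_add_eq_0 add.commute)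
  have b: "a 1 2 * a 2 1 = - (1 + a 1 1 * a 1 1)"
    using sq[of 1 1] zeros by (simp add: ax col)
  then have b_nz: "a 1 2 \<noteq> 0"
    using no_sqrt[of "a 1 1"] by auto
  have "a 1 2 * (a 1 1 + a 2 2) = 0"
    using sq[of 1 2] zeros by (simp add: ax col algebra_simps)
  then have a22: "a 2 2 = - a 1 1"
    using b_nz by (simp add: eq_neg_iff_add_eq_0 add.commute)
  have p: "a 3 3 * (a 1 1 + a 5 5) = 1 - a 1 1 * a 5 5"
    using N[of 1 3 6] zeros a66 by (simp add: g64_component ax col algebra_simps)
  \<comment> \<open>If the sum vanished, \<open>p\<close> would say that 1 + (a 1 1)^2 is
    zero.\<close>
  have D: "a 1 1 + a 5 5 \<noteq> 0"
  proof
    assume "a 1 1 + a 5 5 = 0"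
    then have "a 5 5 = - a 1 1" by simp
    with p no_sqrt[of "a 1 1"] show False by simp
  qed
  have u: "a 3 4 * a 5 6 = - a 2 1 * (a 3 3 + a 5 5)"
    using N[of 1 4 5] zeros a44 by (simp add: g64_component ax col algebra_simps)
  have q: "a 4 3 * (a 1 1 + a 5 5) = - (a 1 2 * a 5 6)"
    using N[of 2 3 5] zeros a22 by (simp add: g64_component ax col algebra_simps)
  have p5: "a 3 4 * a 5 3 = a 3 3 * a 5 4 - a 5 5 * a 5 4 - a 5 6 * a 6 4"
    and p6: "a 3 4 * a 6 3 = a 3 3 * a 6 4 - a 6 5 * a 5 4 + a 5 5 * a 6 4"
    using sq[of 5 4] sq[of 6 4] zeros a44 a66 by (simp_all add: ax col algebra_simps)
  have a_1:
    "a 1 2 * a 3 1 = a 1 1 * a 3 2 - a 3 3 * a 3 2 - a 3 4 * a 4 2"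
    "a 1 2 * a 4 1 = a 1 1 * a 4 2 - a 4 3 * a 3 2 + a 3 3 * a 4 2"
    "a 1 2 * a 5 1 = a 1 1 * a 5 2 - a 5 3 * a 3 2 - a 5 4 * a 4 2 - a 5 5 * a 5 2 - a 5 6 * a 6 2"
    "a 1 2 * a 6 1 = a 1 1 * a 6 2 - a 6 3 * a 3 2 - a 6 4 * a 4 2 - a 6 5 * a 5 2 + a 5 5 * a 6 2"
    using sq[of 3 2] sq[of 4 2] sq[of 5 2] sq[of 6 2] zeros a22 a44 a66
    by (simp_all add: ax col algebra_simps)

  have p': "(1 - a 1 1 * a 5 5) / (a 1 1 + a 5 5) = a 3 3"
    using p D by (simp add: divide_eq_eq)
  have q': "- (a 1 2 * a 5 6 / (a 1 1 + a 5 5)) = a 4 3"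
    using q D by (simp add: field_simps)
  have w': "- ((1 + (a 5 5)\<^sup>2) / a 5 6) = a 6 5"
    using w c_nz by (simp add: field_simps power2_eq_square)
  have a21: "- ((1 + (a 1 1)\<^sup>2) / a 1 2) = a 2 1"
    using b b_nz by (simp add: field_simps power2_eq_square)
  \<comment> \<open>Relation \<open>p\<close> turns \<open>a 3 3 + a 5 5\<close> into (1 + (a 5
    5)^2) / (a 1 1 + a 5 5), and \<open>b\<close> evaluates \<open>a 2 1\<close>; together they
    eliminate both from \<open>u\<close>.\<close>
  have u': "(1 + (a 1 1)\<^sup>2) * (1 + (a 5 5)\<^sup>2) / (a 1 2 * a 5 6 * (a 1 1 + a 5 5)) = a 3 4"
  proof -
    have "(a 3 3 + a 5 5) * (a 1 1 + a 5 5) = 1 + (a 5 5)\<^sup>2"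
      using p by (simp add: algebra_simps power2_eq_square)
    moreover have "a 3 4 * (a 1 2 * a 5 6 * (a 1 1 + a 5 5))
        = a 1 2 * (a 3 4 * a 5 6) * (a 1 1 + a 5 5)"
      by (simp add: algebra_simps)
    moreover have "\<dots> = - (a 1 2 * a 2 1) * ((a 3 3 + a 5 5) * (a 1 1 + a 5 5))"
      unfolding u by (simp add: algebra_simps)
    ultimately have "a 3 4 * (a 1 2 * a 5 6 * (a 1 1 + a 5 5)) = (1 + (a 1 1)\<^sup>2) * (1 + (a 5 5)\<^sup>2)"
      unfolding b by (simp add: power2_eq_square)
    then show ?thesis
      using b_nz c_nz D by (simp add: divide_eq_eq)
  qed
  have p5': "(a 3 3 * a 5 4 - a 5 5 * a 5 4 - a 5 6 * a 6 4) / a 3 4 = a 5 3"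
    and p6': "(a 3 3 * a 6 4 - a 6 5 * a 5 4 + a 5 5 * a 6 4) / a 3 4 = a 6 3"
    unfolding p5[symmetric] p6[symmetric] using u_nz by simp_all
  have a_1':
    "(a 1 1 * a 3 2 - a 3 3 * a 3 2 - a 3 4 * a 4 2) / a 1 2 = a 3 1"
    "(a 1 1 * a 4 2 - a 4 3 * a 3 2 + a 3 3 * a 4 2) / a 1 2 = a 4 1"
    "(a 1 1 * a 5 2 - a 5 3 * a 3 2 - a 5 4 * a 4 2 - a 5 5 * a 5 2 - a 5 6 * a 6 2) / a 1 2 = a 5 1"
    "(a 1 1 * a 6 2 - a 6 3 * a 3 2 - a 6 4 * a 4 2 - a 6 5 * a 5 2 + a 5 5 * a 6 2) / a 1 2 = a 6 1"
    unfolding a_1[symmetric] using b_nz by simp_all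
  show "A \<in> chart64"
    using b_nz c_nz D by (simp add: chart64_def a_def)
  show "graph64 A = A"
    unfolding graph64_def Let_def vec_eq_iff forall_6 vector_6
    unfolding a_def[symmetric] p' q' u' w' p5' p6' a_1' a21
    using zeros a22 a44 a66 by simp
qed

text \<open>The columns are the images forced by fixing x2. In particular column 3 is
  \<open>A\<close> applied to column 4 plus \<open>p\<close> times column 4, because J x4 = x3 - p
  x4 in the normal form.\<close>

definition conj64 :: "real^6^6 \<Rightarrow> real^6^6" where
  "conj64 A =
    (let b = A$1$2; b3 = A$3$2; b4 = A$4$2; b5 = A$5$2; b6 = A$6$2;
         u5 = A$5$4; u6 = A$6$4; \<beta> = A$5$5; p = A$3$3; u = A$3$4; w = A$6$5
     in vector
      [vector [b,  0, 0,   0,    0, 0],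
       vector [0,  1, 0,   0,    0, 0],
       vector [b3, 0, b * u, 0,  0, 0],
       vector [b4, 0, 0,   b,    0, 0],
       vector [b5, 0, b * u5 - b4 * \<beta> - p * b4, - b4,  b, 0],
       vector [b6, 0, b * u6 - b4 * w,  0,    0, b * (b * u)]])"

text \<open>Only the fixed-point equation is assumed, not integrability, so that the result also
  serves to show that fixed points are complex structures.\<close>

lemma graph64_conj:
  assumes A: "A \<in> chart64" "graph64 A = A"
  shows "lie_automorphism g64 ((*v) (conj64 A))"
    and "A ** conj64 A = conj64 A ** J64 (A$1$1) (A$5$5)"
proof -
  define a where "a i j = A $ i $ j" for i j
  define \<alpha> b \<beta> c p u q w where
    "\<alpha> = a 1 1" "b = a 1 2" "\<beta> = a 5 5" "c = a 5 6" "p = a 3 3" "u = a 3 4" "q = a 4 3" "w = a 6 5"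
  note defs = this
  have a: "A $ i $ j = a i j" for i j by (simp add: a_def)
  have nz: "\<alpha> + \<beta> \<noteq> 0" "b \<noteq> 0" "c \<noteq> 0"
    using A by (simp_all add: chart64_def defs a_def)
  have sq_nz: "1 + x\<^sup>2 \<noteq> 0" for x :: real
    by (metis sum_power2_eq_zero_iff one_power2 one_neq_zero)
  have G: "a i j = graph64 A $ i $ j" for i j
    using A by (simp add: a_def)
  note G = G[unfolded graph64_def Let_def a]
  have p: "p = (1 - \<alpha> * \<beta>) / (\<alpha> + \<beta>)"
    unfolding defs by (subst G) (simp add: vector_6)
  have u: "u = (1 + \<alpha>\<^sup>2) * (1 + \<beta>\<^sup>2) / (b * c * (\<alpha> + \<beta>))"
    unfolding defs by (subst G) (simp add: vector_6)
  have q: "q = - (b * c / (\<alpha> + \<beta>))"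
    unfolding defs by (subst G) (simp add: vector_6)
  have w: "w = - ((1 + \<beta>\<^sup>2) / c)"
    unfolding defs by (subst G) (simp add: vector_6)
  have u_nz: "u \<noteq> 0" using nz sq_nz by (simp add: u)
  show "lie_automorphism g64 ((*v) (conj64 A))"
    unfolding conj64_def Let_def a defs[symmetric]
    by (rule lie_automorphism_g64I) (use nz u_nz in simp_all)
  have a13: "a 1 3 = 0" by (subst G) (simp add: vector_6)
  have a14: "a 1 4 = 0" by (subst G) (simp add: vector_6)
  have a15: "a 1 5 = 0" by (subst G) (simp add: vector_6)
  have a16: "a 1 6 = 0" by (subst G) (simp add: vector_6)
  have a23: "a 2 3 = 0" by (subst G) (simp add: vector_6)
  have a24: "a 2 4 = 0" by (subst G) (simp add: vector_6)
  have a25: "a 2 5 = 0" by (subst G) (simp add: vector_6)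
  have a26: "a 2 6 = 0" by (subst G) (simp add: vector_6)
  have a35: "a 3 5 = 0" by (subst G) (simp add: vector_6)
  have a36: "a 3 6 = 0" by (subst G) (simp add: vector_6)
  have a45: "a 4 5 = 0" by (subst G) (simp add: vector_6)
  have a46: "a 4 6 = 0" by (subst G) (simp add: vector_6)
  have a22: "a 2 2 = - \<alpha>" unfolding p defs by (subst G) (simp add: vector_6)
  have a44: "a 4 4 = - p" unfolding p defs by (subst G) (simp add: vector_6)
  have a66: "a 6 6 = - \<beta>" unfolding p defs by (subst G) (simp add: vector_6)
  have a21: "a 2 1 = - ((1 + \<alpha>\<^sup>2) / b)" unfolding defs by (subst G) (simp add: vector_6)
  have a53: "a 5 3 = (p * a 5 4 - \<beta> * a 5 4 - c * a 6 4) / u"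
    unfolding p u w defs by (subst G) (simp add: vector_6)
  have a63: "a 6 3 = (p * a 6 4 - w * a 5 4 + \<beta> * a 6 4) / u"
    unfolding p u w defs by (subst G) (simp add: vector_6)
  have a31: "a 3 1 = (\<alpha> * a 3 2 - p * a 3 2 - u * a 4 2) / b"
    unfolding p u defs by (subst G) (simp add: vector_6)
  have a41: "a 4 1 = (\<alpha> * a 4 2 - q * a 3 2 + p * a 4 2) / b"
    unfolding p q defs by (subst G) (simp add: vector_6)
  have a51: "a 5 1 = (\<alpha> * a 5 2 - a 5 3 * a 3 2 - a 5 4 * a 4 2 - \<beta> * a 5 2 - c * a 6 2) / b"
    unfolding a53 p u defs by (subst G) (simp add: vector_6)
  have a61: "a 6 1 = (\<alpha> * a 6 2 - a 6 3 * a 3 2 - a 6 4 * a 4 2 - w * a 5 2 + \<beta> * a 6 2) / b"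
    unfolding a63 p u w defs by (subst G) (simp add: vector_6)
  note zeros = a13 a14 a15 a16 a23 a24 a25 a26 a35 a36 a45 a46
  note sqs = sq_nz[of \<alpha>] sq_nz[of \<beta>]
  have uq: "u * q = - (1 + p\<^sup>2)"
    unfolding u q p using nz sqs by (simp add: divide_simps) algebra
  have cw: "c * w = - (1 + \<beta>\<^sup>2)"
    unfolding w using nz by simp
  \<comment> \<open>Entries of the normal form, next compared with those of \<open>A\<close>: they
    differ by ratios of diagonal entries of \<open>conj64 A\<close>.\<close>
  define j43 j56 j65 where "j43 = J64 \<alpha> \<beta> $ 4 $ 3" "j56 = J64 \<alpha> \<beta> $ 5 $ 6" "j65 = J64 \<alpha> \<beta> $ 6 $ 5"
  note j_defs = this
  have j43: "j43 = u * q"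
    unfolding j_defs u q J64_components vector_6 using nz sqs by (simp add: divide_simps) algebra
  have j56: "j56 = b * u * c"
    unfolding j_defs u J64_components vector_6 using nz sqs by (simp add: divide_simps) algebra
  have j65: "b * u * j65 = w"
    unfolding j_defs u w J64_components vector_6 using nz sqs
    by (simp add: divide_simps add.commute[of 1])
  have p_neg: "(\<alpha> * \<beta> - 1) / (\<alpha> + \<beta>) = - p"
    unfolding p minus_divide_left by simp
  have J: "J64 \<alpha> \<beta> = vector
    [vector [\<alpha>, 1, 0, 0, 0, 0],
     vector [- (\<alpha>^2 + 1), - \<alpha>, 0, 0, 0, 0],
     vector [0, 0, p, 1, 0, 0],
     vector [0, 0, j43, - p, 0, 0],
     vector [0, 0, 0, 0, \<beta>, j56],
     vector [0, 0, 0, 0, j65, - \<beta>]]"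
    unfolding vec_eq_iff[of "J64 \<alpha> \<beta>"] forall_6 j_defs
    unfolding J64_components vector_6 p[symmetric] p_neg by simp
  \<comment> \<open>The fixed-point equations cleared of denominators, so that the intertwining
    relation becomes a polynomial identity in each entry.\<close>
  have cols: "b * a 2 1 = - (1 + \<alpha>\<^sup>2)" "u * a 5 3 = p * a 5 4 - \<beta> * a 5 4 - c * a 6 4"
    "u * a 6 3 = p * a 6 4 - w * a 5 4 + \<beta> * a 6 4"
    "b * a 3 1 = \<alpha> * a 3 2 - p * a 3 2 - u * a 4 2"
    "b * a 4 1 = \<alpha> * a 4 2 - q * a 3 2 + p * a 4 2"
    "b * a 5 1 = \<alpha> * a 5 2 - a 5 3 * a 3 2 - a 5 4 * a 4 2 - \<beta> * a 5 2 - c * a 6 2"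
    "b * a 6 1 = \<alpha> * a 6 2 - a 6 3 * a 3 2 - a 6 4 * a 4 2 - w * a 5 2 + \<beta> * a 6 2"
    unfolding a21 a53 a63 a31 a41 a51 a61 using nz u_nz by simp_all
  have "A ** conj64 A = conj64 A ** J64 \<alpha> \<beta>"
    unfolding vec_eq_iff forall_6 matrix_matrix_mult_def vec_lambda_beta sum_6
      conj64_def Let_def J vector_6 a zeros a22 a44 a66
    unfolding defs[symmetric]
    by (intro conjI; (insert cols uq cw j43 j56 j65, simp?, algebra?))
  then show "A ** conj64 A = conj64 A ** J64 (A$1$1) (A$5$5)"
    by (simp add: defs a)
qed

text \<open>For the converse inclusion, integrability of a fixed point need not be checked by hand:
  it is conjugate to a normal form, and conjugation preserves complex structures.\<close>

lemma complex_structures_g64_eq_fixed_points: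
  "complex_structures g64 = {A \<in> chart64. graph64 A = A}"
proof (intro equalityI subsetI CollectI conjI)
  fix A assume "A \<in> complex_structures g64"
  then show "A \<in> chart64" "graph64 A = A"
    by (rule complex_structures_g64_chart)+
next
  fix A assume "A \<in> {A \<in> chart64. graph64 A = A}"
  then have A: "A \<in> chart64" "graph64 A = A" by auto
  then have "J64 (A$1$1) (A$5$5) \<in> aut_orbit g64 A"
    using graph64_conj mem_aut_orbitI by blast
  moreover have "J64 (A$1$1) (A$5$5) \<in> complex_structures g64"
    using A by (intro J64_complex_structure) (simp add: chart64_def)
  ultimately show "A \<in> complex_structures g64"
    using mem_aut_orbit_sym complex_structures_conj by (fastforce simp: aut_orbit_def)
qed

section \<open>Dimension ten, and the orbit decomposition\<close>

section \<open>The submanifold\<close>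

definition free64 :: "(6 \<times> 6) set" where
  "free64 = {(1,1), (1,2), (5,5), (5,6), (3,2), (4,2), (5,2), (6,2), (5,4), (6,4)}"

lemma inner_axis_axis_1:
  fixes A :: "real^'n^'m"
  shows "A \<bullet> axis i (axis j 1) = A $ i $ j"
  by (simp add: inner_axis)

lemma open_chart64: "open chart64"
  unfolding chart64_def
  by (intro open_Collect_conj open_Collect_neq continuous_intros)

lemma smooth_map_on_entry:
  "open U \<Longrightarrow> smooth_map_on U (\<lambda>A::real^'n^'m. A $ i $ j)"
  unfolding inner_axis_axis_1[symmetric]
  by (intro smooth_map_on_bounded_linear bounded_linear_inner_left)

lemma smooth_graph64: "smooth_map_on chart64 graph64"
proof (rule smooth_map_on_componentwise[OF open_chart64])
  have sq_nz: "1 + x\<^sup>2 \<noteq> 0" for x :: real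
    by (metis sum_power2_eq_zero_iff one_power2 one_neq_zero)
  have "\<forall>i j. smooth_map_on chart64 (\<lambda>A. graph64 A $ i $ j)"
    unfolding forall_6 graph64_def Let_def vector_6
    \<comment> \<open>What the closure rules leave open is that the divisors do not vanish on
      \<open>chart64\<close>.\<close>
    by (intro conjI open_chart64 smooth_map_on_add smooth_map_on_diff smooth_map_on_minus smooth_map_on_mult
        smooth_map_on_divide smooth_map_on_power smooth_map_on_const smooth_map_on_entry)
      (simp_all add: chart64_def sq_nz)
  then show "smooth_map_on chart64 (\<lambda>A. graph64 A \<bullet> e)" if "e \<in> Basis" for e
    using that by (auto simp: Basis_vec_def inner_axis_axis_1)
qed

lemma smooth_submanifold_complex_structures_g64:
  "smooth_submanifold 10 (complex_structures g64)"
proof -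
  define D :: "(real^6^6) set" where "D = (\<lambda>(i, j). axis i (axis j 1)) ` free64"
  have eqD: "\<forall>(i, j)\<in>free64. x$i$j = y$i$j" if "\<And>b. b \<in> D \<Longrightarrow> x \<bullet> b = y \<bullet> b" for x y
    using that by (force simp: D_def simp flip: inner_axis_axis_1)
  \<comment> \<open>Distinct index pairs give distinct matrix units, so the dimension is the number
    of free entries.\<close>
  have "inj (\<lambda>(i, j). axis i (axis j 1) :: real^6^6)"
    by (auto simp: inj_def axis_eq_axis)
  then have "card D = card free64"
    unfolding D_def by (intro card_image) (rule inj_on_subset, auto)
  then have card: "card D = 10"
    by (simp add: free64_def)
  have "smooth_submanifold (card D) {A \<in> chart64. graph64 A = A}"
  proof (rule smooth_submanifold_graph)
    show "D \<subseteq> Basis"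
      by (auto simp: D_def Basis_vec_def)
    \<comment> \<open>The conditions defining \<open>chart64\<close> involve free entries
      only.\<close>
    show "y \<in> chart64" if "\<And>b. b \<in> D \<Longrightarrow> x \<bullet> b = y \<bullet> b" "x \<in> chart64" for x y
      using eqD[OF that(1)] that(2) by (simp add: chart64_def free64_def)
    show "graph64 x = graph64 y" if "\<And>b. b \<in> D \<Longrightarrow> x \<bullet> b = y \<bullet> b" for x y
      unfolding graph64_def using eqD[OF that, unfolded free64_def, simplified] by (simp only:)
    show "graph64 x \<bullet> b = x \<bullet> b" if "b \<in> D" for x b
      using that by (auto simp: D_def free64_def inner_axis_axis_1 graph64_def Let_def vector_6)
  qed (fact open_chart64 smooth_graph64)+
  then show ?thesis
    by (simp add: complex_structures_g64_eq_fixed_points card)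
qed

theorem mainTheorem3:
  shows "(\<forall>A \<in> complex_structures g64.
            \<exists>\<alpha> \<beta>. \<alpha> \<noteq> - \<beta> \<and> equivalent_cs g64 A (J64 \<alpha> \<beta>)) \<and>
         (\<forall>\<alpha> \<beta> \<alpha>' \<beta>'. \<alpha> \<noteq> - \<beta> \<and> \<alpha>' \<noteq> - \<beta>' \<and> (\<alpha>, \<beta>) \<noteq> (\<alpha>', \<beta>') \<longrightarrow>
            \<not> equivalent_cs g64 (J64 \<alpha> \<beta>) (J64 \<alpha>' \<beta>')) \<and>
         smooth_submanifold 10 (complex_structures g64) \<and>
         complex_structures g64 = (\<Union>(\<alpha>, \<beta>)\<in>params64. aut_orbit g64 (J64 \<alpha> \<beta>)) \<and>
         disjoint_family_on (\<lambda>(\<alpha>, \<beta>). aut_orbit g64 (J64 \<alpha> \<beta>)) params64"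
proof (intro conjI)
  have normal: "J64 (A$1$1) (A$5$5) \<in> aut_orbit g64 A" "A$1$1 \<noteq> - A$5$5"
    if "A \<in> complex_structures g64" for A
    using complex_structures_g64_chart[OF that] graph64_conj mem_aut_orbitI
    by (blast, auto simp: chart64_def)
  show "\<forall>A\<in>complex_structures g64. \<exists>\<alpha> \<beta>. \<alpha> \<noteq> - \<beta> \<and> equivalent_cs g64 A (J64 \<alpha> \<beta>)"
    using normal unfolding equivalent_cs_def by blast
  \<comment> \<open>The entries (1,1) and (5,5) are constant on orbits and equal the parameters on
    the normal forms.\<close>
  show "\<forall>\<alpha> \<beta> \<alpha>' \<beta>'. \<alpha> \<noteq> - \<beta> \<and> \<alpha>' \<noteq> - \<beta>' \<and> (\<alpha>, \<beta>) \<noteq> (\<alpha>', \<beta>') \<longrightarrow>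
      \<not> equivalent_cs g64 (J64 \<alpha> \<beta>) (J64 \<alpha>' \<beta>')"
    using mem_aut_orbit_J64_components
    by (fastforce simp: equivalent_cs_def J64_components vector_6)
  show "smooth_submanifold 10 (complex_structures g64)"
    by (rule smooth_submanifold_complex_structures_g64)
  show "complex_structures g64 = (\<Union>(\<alpha>, \<beta>)\<in>params64. aut_orbit g64 (J64 \<alpha> \<beta>))"
  proof (intro equalityI subsetI)
    fix A assume A: "A \<in> complex_structures g64"
    then have "A \<in> aut_orbit g64 (J64 (A$1$1) (A$5$5))"
      using normal mem_aut_orbit_sym by blast
    moreover have "(A$1$1, A$5$5) \<in> params64"
      using normal[OF A] by (simp add: params64_def)
    ultimately show "A \<in> (\<Union>(\<alpha>, \<beta>)\<in>params64. aut_orbit g64 (J64 \<alpha> \<beta>))"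
      by blast
  next
    fix A assume "A \<in> (\<Union>(\<alpha>, \<beta>)\<in>params64. aut_orbit g64 (J64 \<alpha> \<beta>))"
    then obtain \<alpha> \<beta> where "\<alpha> \<noteq> - \<beta>" "A \<in> aut_orbit g64 (J64 \<alpha> \<beta>)"
      by (auto simp: params64_def)
    then show "A \<in> complex_structures g64"
      using J64_complex_structure[of \<alpha> \<beta>] complex_structures_conj
      by (auto simp: aut_orbit_def add_eq_0_iff2)
  qed
  \<comment> \<open>A common element of two orbits would carry both parameter pairs in its entries
    (1,1) and (5,5).\<close>
  show "disjoint_family_on (\<lambda>(\<alpha>, \<beta>). aut_orbit g64 (J64 \<alpha> \<beta>)) params64"
    unfolding disjoint_family_on_def
    by safe (metis mem_aut_orbit_J64_components)+
qed

end
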